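(* Let $(X,D)$ be a metric space with base point $x_0$ and let $P$ be a cone in $L=\mathrm{Lip}_0(X,D)$ such that every $\phi\in L$ can be written $\phi=\phi_1-\phi_2$ with $\phi_1,\phi_2\in P$ and $\max\{\|\phi_1\|_L,\|\phi_2\|_L\}\le\|\phi\|_L\le\|\phi_1\|_L+\|\phi_2\|_L$. Let $D_P$ be the corresponding $P$-asymmetrization of $D$. Then the symmetrizations of $(\mathcal{F}(X,D),\|\cdot|_{\mathcal{F}_P})$ and of $(\mathcal{F}_a(X,D_P),\|\cdot|_{\mathcal{F}_a})$ are both isomorphic to the Lipschitz-free space $(\mathcal{F}(X,D),\|\cdot\|_{\mathcal{F}})$.
   Context: Cones in a real vector space are convex cones. $\mathrm{Lip}_0(X,D)$ is the Banach space of real Lipschitz functions on $(X,D)$ vanishing at $x_0$, with $\|\phi\|_L=\sup_{x\ne y}|\phi(x)-\phi(y)|/D(x,y)$. With $\widehat\delta_x\in L^*$ the evaluation at $x$, the Lipschitz-free space $\mathcal{F}(X,D)$ is the norm-closed linear span of $\{\widehat\delta_x:x\in X\}$ in $L^*$, with norm $\|\cdot\|_{\mathcal{F}}$ inherited from $L^*$. For $Q\in\mathcal{F}(X,D)$ put $\|Q|_{\mathcal{F}_P}=\sup\{\langle\phi,Q\rangle:\phi\in P,\ \|\phi\|_L\le1\}$, and for $x,y\in X$ put $D_P(x,y)=\|\widehat\delta_y-\widehat\delta_x|_{\mathcal{F}_P}=\sup\{\phi(y)-\phi(x):\phi\in P,\|\phi\|_L\le1\}$. Then $\|\cdot|_{\mathcal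 F_P}$ is an asymmetric (hemi-)norm and $D_P$ is a quasi-(hemi-)metric (it satisfies the triangle inequality and $x=y\iff D_P(x,y)=D_P(y,x)=0$, but is not symmetric in general). An asymmetric normed space is a real vector space $E$ with $\|\cdot|:E\to[0,\infty)$ that is subadditive, satisfies $\|rx|=r\|x|$ for $r>0$, and either ($x=0\iff\|x|=0$) or ($x=0\iff\|x|=\|{-x}|=0$). Its symmetrization is $E$ with the norm $\|x|+\|{-x}|$ (or, equivalently, $\max\{\|x|,\|{-x}|\}$). Its bicompletion is the (unique up to isometric isomorphism) asymmetric normed space, complete for the symmetrized norm, in which it embeds by a linear isometry with image dense for the symmetrized norm. For a quasi-metric space $(X,d)$ with base point $x_0$ (here $d=D_P$): $\mathrm{SLip}_0(X,d)$ is the cone of $f:X\to\mathbb{R}$ with $f(x_0)=0$ for which there is $C>0$ with $f(x)-f(y)\le C\,d(y,x)$ for all $x,y$, and $\|f|_S$ is the infimum of such $C$. Let $\delta_x$ be the evaluation at $x$ on $\mathrm{SLip}_0(X,d)$. On $\mathrm{span}\{\delta_x:x\in X\}$ (a vector space of functions on $\mathrm{SLip}_0(X,d)$) put $\|Q|_{\mathcal{F}_a}=\sup\{Q(f):\|f|_S\le1\}$, an asymmetric (hemi-)norm. The semi-Lipschitz free space $(\mathcal{F}_a(X,d),\|\cdot|_{\mathcal{F}_a})$ is the bicompletion of this space. "Isomorphic" means linearly isomorphic as normed spaces (bounded linear bijection with bounded inverse). *)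

theory Defs
  imports "HOL-Analysis.Analysis" "HOL-Library.Function_Algebras"
begin

section \<open>Pointed metric spaces and \<open>Lip\<^sub>0\<close>\<close>

text \<open>The metric is \<^const>\<open>dist\<close>; the base point is arbitrary and otherwise unconstrained.\<close>

class pointed_metric_space = metric_space +
  fixes basepoint :: 'a

typedef (overloaded) 'a lip0 =
  "{f :: 'a::pointed_metric_space \<Rightarrow> real. f basepoint = 0 \<and> (\<exists>C. C-lipschitz_on UNIV f)}"
  morphisms lip_apply Lip0
proof
  show "(\<lambda>_. 0) \<in> {f :: 'a \<Rightarrow> real. f basepoint = 0 \<and> (\<exists>C. C-lipschitz_on UNIV f)}"
    by (auto intro!: exI[of _ 0] lipschitz_onI)
qed

setup_lifting type_definition_lip0

lemma lip_apply_eqI: "(\<And>x. lip_apply f x = lip_apply g x) \<Longrightarrow> f = g"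
  by transfer auto

lemma lip_apply_basepoint [simp]: "lip_apply f basepoint = 0"
  by transfer auto

lemma lip_apply_lipschitz: "\<exists>C. C-lipschitz_on UNIV (lip_apply f)"
  by transfer auto

instantiation lip0 :: (pointed_metric_space) real_vector
begin

lift_definition zero_lip0 :: "'a lip0" is "\<lambda>_. 0"
  by (auto intro!: exI[of _ 0] lipschitz_onI)

lift_definition plus_lip0 :: "'a lip0 \<Rightarrow> 'a lip0 \<Rightarrow> 'a lip0" is "\<lambda>f g x. f x + g x"
  by (auto intro: lipschitz_on_add)

lift_definition minus_lip0 :: "'a lip0 \<Rightarrow> 'a lip0 \<Rightarrow> 'a lip0" is "\<lambda>f g x. f x - g x"
  by (auto intro: lipschitz_on_diff)

lift_definition uminus_lip0 :: "'a lip0 \<Rightarrow> 'a lip0" is "\<lambda>f x. - f x"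
  by (auto simp: lipschitz_on_def dist_minus)

lift_definition scaleR_lip0 :: "real \<Rightarrow> 'a lip0 \<Rightarrow> 'a lip0" is "\<lambda>c f x. c * f x"
  by (auto intro: lipschitz_on_cmult_real)

instance
  by standard (transfer; auto simp: fun_eq_iff algebra_simps)+

end

lemma lip_apply_zero [simp]: "lip_apply 0 x = 0"
  and lip_apply_add [simp]: "lip_apply (f + g) x = lip_apply f x + lip_apply g x"
  and lip_apply_diff [simp]: "lip_apply (f - g) x = lip_apply f x - lip_apply g x"
  and lip_apply_minus [simp]: "lip_apply (- f) x = - lip_apply f x"
  and lip_apply_scaleR [simp]: "lip_apply (c *\<^sub>R f) x = c * lip_apply f x"
  by (transfer; simp)+

instantiation lip0 :: (pointed_metric_space) real_normed_vector
begin

text \<open>The supremum may include the diagonal, whose quotients are \<open>0 / 0 = 0\<close>; in this way it is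
  also correct (namely \<open>0\<close>) for a one-point space.\<close>

definition norm_lip0 :: "'a lip0 \<Rightarrow> real" where
  "norm_lip0 f = (SUP (x, y). \<bar>lip_apply f x - lip_apply f y\<bar> / dist x y)"

definition dist_lip0 :: "'a lip0 \<Rightarrow> 'a lip0 \<Rightarrow> real" where
  "dist_lip0 f g = norm (f - g)"

definition sgn_lip0 :: "'a lip0 \<Rightarrow> 'a lip0" where
  "sgn_lip0 f = f /\<^sub>R norm f"

definition uniformity_lip0 :: "('a lip0 \<times> 'a lip0) filter" where
  "uniformity_lip0 = (INF e\<in>{0 <..}. principal {(x, y). dist x y < e})"

definition open_lip0 :: "'a lip0 set \<Rightarrow> bool" where
  "open_lip0 S = (\<forall>x\<in>S. \<forall>\<^sub>F (x', y) in uniformity. x' = x \<longrightarrow> y \<in> S)"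

lemma bdd_above_lip0:
  "bdd_above (range (\<lambda>(x, y). \<bar>lip_apply f x - lip_apply f y\<bar> / dist x y))"
proof -
  obtain C where "C-lipschitz_on UNIV (lip_apply f)"
    using lip_apply_lipschitz by blast
  then have "\<bar>lip_apply f x - lip_apply f y\<bar> / dist x y \<le> C" for x y
    by (cases "x = y")
      (auto simp: lipschitz_on_def dist_real_def divide_simps mult.commute split: if_splits)
  then show ?thesis
    by (intro bdd_aboveI[of _ C]) auto
qed

lemma lip0_le_norm: "\<bar>lip_apply f x - lip_apply f y\<bar> \<le> norm f * dist x y"
proof (cases "x = y")
  case False
  have "\<bar>lip_apply f x - lip_apply f y\<bar> / dist x y \<le> norm f"
    unfolding norm_lip0_def using cSUP_upper[OF _ bdd_above_lip0, of "(x, y)" f] by simp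
  with False show ?thesis
    by (simp add: divide_simps split: if_splits)
qed simp

lemma lip0_norm_leI:
  assumes "\<And>x y. \<bar>lip_apply f x - lip_apply f y\<bar> \<le> C * dist x y" and "0 \<le> C"
  shows "norm f \<le> C"
  unfolding norm_lip0_def
proof (rule cSUP_least)
  fix p :: "'a \<times> 'a"
  show "(case p of (x, y) \<Rightarrow> \<bar>lip_apply f x - lip_apply f y\<bar> / dist x y) \<le> C"
    using assms by (cases p; cases "fst p = snd p") (auto simp: divide_simps)
qed simp

lemma lip0_norm_nonneg: "0 \<le> norm (f :: 'a lip0)"
  unfolding norm_lip0_def
  using cSUP_upper[OF _ bdd_above_lip0, of "(basepoint, basepoint)" f] by simp

instance
proof
  fix f g :: "'a lip0" and c :: real
  show "dist f g = norm (f - g)" by (rule dist_lip0_def)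
  show "sgn f = f /\<^sub>R norm f" by (rule sgn_lip0_def)
  show "uniformity = (INF e\<in>{0<..}. principal {(x :: 'a lip0, y). dist x y < e})"
    by (rule uniformity_lip0_def)
  show "open S = (\<forall>x\<in>S. \<forall>\<^sub>F (x', y) in uniformity. x' = x \<longrightarrow> y \<in> S)" for S :: "'a lip0 set"
    by (rule open_lip0_def)
  show "norm f = 0 \<longleftrightarrow> f = 0"
  proof
    assume "norm f = 0"
    then show "f = 0"
      using lip0_le_norm[of f _ basepoint] by (intro lip_apply_eqI) simp
  next
    assume "f = 0"
    then have "norm f \<le> 0" by (intro lip0_norm_leI) auto
    then show "norm f = 0" using lip0_norm_nonneg[of f] by simp
  qed
  show "norm (f + g) \<le> norm f + norm g"
  proof (rule lip0_norm_leI)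
    fix x y
    show "\<bar>lip_apply (f + g) x - lip_apply (f + g) y\<bar> \<le> (norm f + norm g) * dist x y"
      using lip0_le_norm[of f x y] lip0_le_norm[of g x y] unfolding lip_apply_add distrib_right
      by linarith
  qed (simp add: lip0_norm_nonneg)
  have le: "norm (c *\<^sub>R f) \<le> \<bar>c\<bar> * norm f" for c and f :: "'a lip0"
  proof (rule lip0_norm_leI)
    fix x y
    have "\<bar>lip_apply (c *\<^sub>R f) x - lip_apply (c *\<^sub>R f) y\<bar> = \<bar>c\<bar> * \<bar>lip_apply f x - lip_apply f y\<bar>"
      by (simp add: abs_mult flip: right_diff_distrib)
    also have "\<dots> \<le> \<bar>c\<bar> * (norm f * dist x y)"
      by (intro mult_left_mono lip0_le_norm) simp
    finally show "\<bar>lip_apply (c *\<^sub>R f) x - lip_apply (c *\<^sub>R f) y\<bar> \<le> \<bar>c\<bar> * norm f * dist x y"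
      by (simp add: mult.assoc)
  qed (simp add: lip0_norm_nonneg)
  show "norm (c *\<^sub>R f) = \<bar>c\<bar> * norm f"
  proof (cases "c = 0")
    case True
    then show ?thesis using le[of c f] lip0_norm_nonneg[of "c *\<^sub>R f"] by simp
  next
    case False
    then have "\<bar>c\<bar> * norm f \<le> norm (c *\<^sub>R f)"
      using le[of "inverse c" "c *\<^sub>R f"] by (simp add: field_simps abs_inverse)
    with le[of c f] show ?thesis by simp
  qed
qed

end

section \<open>The Lipschitz-free space and the norms attached to a cone\<close>

lift_definition lip_delta :: "'a::pointed_metric_space \<Rightarrow> ('a lip0 \<Rightarrow>\<^sub>L real)"
  is "\<lambda>x f. lip_apply f x"
proof
  fix x :: 'a
  show "\<exists>K. \<forall>f. norm (lip_apply f x) \<le> norm f * K"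
    using lip0_le_norm[of _ x basepoint] by (intro exI[of _ "dist x basepoint"]) simp
qed simp_all

definition lip_free :: "('a::pointed_metric_space lip0 \<Rightarrow>\<^sub>L real) set" where
  "lip_free = closure (span (range lip_delta))"

definition cone_norm :: "'a::pointed_metric_space lip0 set \<Rightarrow> ('a lip0 \<Rightarrow>\<^sub>L real) \<Rightarrow> real" where
  "cone_norm P Q = (SUP \<phi>\<in>{\<phi>\<in>P. norm \<phi> \<le> 1}. blinfun_apply Q \<phi>)"

definition cone_dist :: "'a::pointed_metric_space lip0 set \<Rightarrow> 'a \<Rightarrow> 'a \<Rightarrow> real" where
  "cone_dist P x y = cone_norm P (lip_delta y - lip_delta x)"

lemma cone_dist_eq:
  "cone_dist P x y = (SUP \<phi>\<in>{\<phi>\<in>P. norm \<phi> \<le> 1}. lip_apply \<phi> y - lip_apply \<phi> x)"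
  by (simp add: cone_dist_def cone_norm_def minus_blinfun.rep_eq lip_delta.rep_eq)

section \<open>Asymmetric normed spaces\<close>

text \<open>All spaces are given by a carrier in an ambient real vector space together with a function
  of which only the values on the carrier matter.\<close>

definition asym_normed_space :: "'v::real_vector set \<Rightarrow> ('v \<Rightarrow> real) \<Rightarrow> bool" where
  "asym_normed_space E n \<longleftrightarrow>
     subspace E \<and>
     (\<forall>x\<in>E. 0 \<le> n x) \<and>
     (\<forall>x\<in>E. \<forall>y\<in>E. n (x + y) \<le> n x + n y) \<and>
     (\<forall>x\<in>E. \<forall>r>0. n (r *\<^sub>R x) = r * n x) \<and>
     ((\<forall>x\<in>E. x = 0 \<longleftrightarrow> n x = 0) \<or> (\<forall>x\<in>E. x = 0 \<longleftrightarrow> n x = 0 \<and> n (- x) = 0))"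

definition symmetrization :: "('v::real_vector \<Rightarrow> real) \<Rightarrow> 'v \<Rightarrow> real" where
  "symmetrization n x = n x + n (- x)"

definition normed_space_on :: "'v::real_vector set \<Rightarrow> ('v \<Rightarrow> real) \<Rightarrow> bool" where
  "normed_space_on E n \<longleftrightarrow>
     subspace E \<and>
     (\<forall>x\<in>E. 0 \<le> n x) \<and>
     (\<forall>x\<in>E. n x = 0 \<longleftrightarrow> x = 0) \<and>
     (\<forall>x\<in>E. \<forall>y\<in>E. n (x + y) \<le> n x + n y) \<and>
     (\<forall>x\<in>E. \<forall>r. n (r *\<^sub>R x) = \<bar>r\<bar> * n x)"

definition complete_space_on :: "'v::real_vector set \<Rightarrow> ('v \<Rightarrow> real) \<Rightarrow> bool" where
  "complete_space_on E n \<longleftrightarrow>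
     (\<forall>X. (\<forall>k. X k \<in> E) \<and> (\<forall>e>0. \<exists>N. \<forall>j\<ge>N. \<forall>k\<ge>N. n (X j - X k) < e) \<longrightarrow>
        (\<exists>L\<in>E. (\<lambda>k::nat. n (X k - L)) \<longlonglongrightarrow> 0))"

definition linear_map_on ::
  "'v::real_vector set \<Rightarrow> 'w::real_vector set \<Rightarrow> ('v \<Rightarrow> 'w) \<Rightarrow> bool" where
  "linear_map_on E F f \<longleftrightarrow>
     f ` E \<subseteq> F \<and>
     (\<forall>x\<in>E. \<forall>y\<in>E. f (x + y) = f x + f y) \<and>
     (\<forall>x\<in>E. \<forall>r. f (r *\<^sub>R x) = r *\<^sub>R f x)"

definition normed_isomorphic ::
  "'v::real_vector set \<Rightarrow> ('v \<Rightarrow> real) \<Rightarrow> 'w::real_vector set \<Rightarrow> ('w \<Rightarrow> real) \<Rightarrow> bool" where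
  "normed_isomorphic E n F m \<longleftrightarrow>
     normed_space_on E n \<and> normed_space_on F m \<and>
     (\<exists>f. linear_map_on E F f \<and> bij_betw f E F \<and>
        (\<exists>C. \<forall>x\<in>E. m (f x) \<le> C * n x) \<and>
        (\<exists>C. \<forall>y\<in>F. n (inv_into E f y) \<le> C * m y))"

definition is_bicompletion ::
  "'v::real_vector set \<Rightarrow> ('v \<Rightarrow> real) \<Rightarrow> 'e::real_vector set \<Rightarrow> ('e \<Rightarrow> real) \<Rightarrow> bool" where
  "is_bicompletion V n E m \<longleftrightarrow>
     asym_normed_space E m \<and>
     complete_space_on E (symmetrization m) \<and>
     (\<exists>i. linear_map_on V E i \<and>
        (\<forall>x\<in>V. m (i x) = n x) \<and>
        (\<forall>y\<in>E. \<forall>e>0. \<exists>x\<in>V. symmetrization m (y - i x) < e))"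

section \<open>The semi-Lipschitz free space\<close>

instantiation "fun" :: (type, real_vector) real_vector
begin

definition scaleR_fun :: "real \<Rightarrow> ('a \<Rightarrow> 'b) \<Rightarrow> 'a \<Rightarrow> 'b" where
  "scaleR_fun c f = (\<lambda>x. c *\<^sub>R f x)"

instance
  by standard (simp_all add: scaleR_fun_def fun_eq_iff algebra_simps)

end

lemma scaleR_fun_apply [simp]: "(c *\<^sub>R f) x = c *\<^sub>R f x"
  by (simp add: scaleR_fun_def)

definition SLip0 :: "('a::pointed_metric_space \<Rightarrow> 'a \<Rightarrow> real) \<Rightarrow> ('a \<Rightarrow> real) set" where
  "SLip0 d = {f. f basepoint = 0 \<and> (\<exists>C>0. \<forall>x y. f x - f y \<le> C * d y x)}"

definition slip_norm :: "('a \<Rightarrow> 'a \<Rightarrow> real) \<Rightarrow> ('a \<Rightarrow> real) \<Rightarrow> real" where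
  "slip_norm d f = Inf {C. C > 0 \<and> (\<forall>x y. f x - f y \<le> C * d y x)}"

text \<open>Real functions on \<^term>\<open>SLip0 d\<close> are represented by functions on the whole type that
  vanish outside \<^term>\<open>SLip0 d\<close>.\<close>

definition slip_delta ::
  "('a::pointed_metric_space \<Rightarrow> 'a \<Rightarrow> real) \<Rightarrow> 'a \<Rightarrow> (('a \<Rightarrow> real) \<Rightarrow> real)" where
  "slip_delta d x = (\<lambda>f. if f \<in> SLip0 d then f x else 0)"

definition slip_dual_norm ::
  "('a::pointed_metric_space \<Rightarrow> 'a \<Rightarrow> real) \<Rightarrow> (('a \<Rightarrow> real) \<Rightarrow> real) \<Rightarrow> real" where
  "slip_dual_norm d Q = (SUP f\<in>{f\<in>SLip0 d. slip_norm d f \<le> 1}. Q f)"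

text \<open>A bicompletion is only determined up to isometric isomorphism, so being a semi-Lipschitz
  free space over \<open>d\<close> is a predicate; a concrete instance is constructed below.\<close>

definition is_semi_lipschitz_free ::
  "('a::pointed_metric_space \<Rightarrow> 'a \<Rightarrow> real) \<Rightarrow> 'e::real_vector set \<Rightarrow> ('e \<Rightarrow> real) \<Rightarrow> bool" where
  "is_semi_lipschitz_free d E n \<longleftrightarrow>
     is_bicompletion (span (range (slip_delta d))) (slip_dual_norm d) E n"

lemma sup_norm_bicompletion_exists:
  fixes V :: "('s \<Rightarrow> real) set" and B :: "'s set"
  assumes V: "subspace V" and b0: "b0 \<in> B" "\<And>Q. Q \<in> V \<Longrightarrow> Q b0 = 0"
    and bdd: "\<And>Q. Q \<in> V \<Longrightarrow> \<exists>K. \<forall>f\<in>B. \<bar>Q f\<bar> \<le> K"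
  shows "\<exists>(E :: ('s \<Rightarrow> real) set) m. is_bicompletion V (\<lambda>Q. SUP f\<in>B. Q f) E m"
proof -
  define E where "E = {R. (\<forall>f. f \<notin> B \<longrightarrow> R f = 0) \<and> (\<forall>e>0. \<exists>Q\<in>V. \<forall>f\<in>B. \<bar>R f - Q f\<bar> \<le> e)}"
  define m :: "('s \<Rightarrow> real) \<Rightarrow> real" where "m R = (SUP f\<in>B. R f)" for R
  define i :: "('s \<Rightarrow> real) \<Rightarrow> 's \<Rightarrow> real" where "i Q = (\<lambda>f. if f \<in> B then Q f else 0)" for Q
  have approx: "\<exists>Q\<in>V. \<forall>f\<in>B. \<bar>R f - Q f\<bar> \<le> e" if "R \<in> E" "e > 0" for R e
    using that by (auto simp: E_def)
  have outside: "R f = 0" if "R \<in> E" "f \<notin> B" for R f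
    using that by (auto simp: E_def)
  have Ebdd: "\<exists>K. \<forall>f\<in>B. \<bar>R f\<bar> \<le> K" if R: "R \<in> E" for R
  proof -
    obtain Q where Q: "Q \<in> V" "\<forall>f\<in>B. \<bar>R f - Q f\<bar> \<le> 1"
      using approx[OF R, of 1] by auto
    obtain K where K: "\<forall>f\<in>B. \<bar>Q f\<bar> \<le> K" using bdd Q by blast
    have "\<bar>R f\<bar> \<le> K + 1" if "f \<in> B" for f
      using bspec[OF K that] bspec[OF Q(2) that] by linarith
    then show ?thesis by blast
  qed
  have E0: "R b0 = 0" if R: "R \<in> E" for R
  proof (rule ccontr)
    assume "R b0 \<noteq> 0"
    then obtain Q where "Q \<in> V" "\<forall>f\<in>B. \<bar>R f - Q f\<bar> \<le> \<bar>R b0\<bar> / 2"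
      using approx[OF R, of "\<bar>R b0\<bar> / 2"] by auto
    then have "\<bar>R b0\<bar> \<le> \<bar>R b0\<bar> / 2" using b0 by fastforce
    with \<open>R b0 \<noteq> 0\<close> show False by simp
  qed
  have iE: "i Q \<in> E" if "Q \<in> V" for Q
    using that by (auto simp: E_def i_def intro!: bexI[of _ Q])
  have add: "R + S \<in> E" if RS: "R \<in> E" "S \<in> E" for R S
    unfolding E_def
  proof safe
    fix f assume "f \<notin> B" then show "(R + S) f = 0" using outside[OF RS(1)] outside[OF RS(2)] by simp
  next
    fix e :: real assume "e > 0"
    then obtain Q T where QT: "Q \<in> V" "\<forall>f\<in>B. \<bar>R f - Q f\<bar> \<le> e / 2"
      "T \<in> V" "\<forall>f\<in>B. \<bar>S f - T f\<bar> \<le> e / 2"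
      using approx[OF RS(1), of "e / 2"] approx[OF RS(2), of "e / 2"] by auto
    have "\<bar>(R + S) f - (Q + T) f\<bar> \<le> e" if "f \<in> B" for f
      using bspec[OF QT(2) that] bspec[OF QT(4) that]
        abs_diff_triangle_ineq[of "R f" "S f" "Q f" "T f"]
      by simp
    then show "\<exists>Q\<in>V. \<forall>f\<in>B. \<bar>(R + S) f - Q f\<bar> \<le> e"
      using QT V subspace_add by blast
  qed
  have scale: "c *\<^sub>R R \<in> E" if R: "R \<in> E" for R c
    unfolding E_def
  proof safe
    fix f assume "f \<notin> B" then show "(c *\<^sub>R R) f = 0" using outside[OF R] by simp
  next
    fix e :: real assume "e > 0"
    then have "e / (\<bar>c\<bar> + 1) > 0" by simp
    then obtain Q where Q: "Q \<in> V" "\<forall>f\<in>B. \<bar>R f - Q f\<bar> \<le> e / (\<bar>c\<bar> + 1)"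
      using approx[OF R] by blast
    have "\<bar>(c *\<^sub>R R) f - (c *\<^sub>R Q) f\<bar> \<le> e" if "f \<in> B" for f
    proof -
      have "\<bar>(c *\<^sub>R R) f - (c *\<^sub>R Q) f\<bar> = \<bar>c\<bar> * \<bar>R f - Q f\<bar>"
        by (simp add: abs_mult flip: right_diff_distrib)
      also have "\<dots> \<le> (\<bar>c\<bar> + 1) * (e / (\<bar>c\<bar> + 1))"
        using bspec[OF Q(2) that] by (intro mult_mono) auto
      also have "\<dots> = e" by (simp add: field_simps)
      finally show ?thesis .
    qed
    then show "\<exists>Q\<in>V. \<forall>f\<in>B. \<bar>(c *\<^sub>R R) f - Q f\<bar> \<le> e"
      using Q V subspace_scale by blast
  qed
  have zero: "0 \<in> E" using scale[OF iE[OF subspace_0[OF V]], of 0] by simp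
  have sub: "subspace E" unfolding subspace_def using add scale zero by blast
  have upper: "R f \<le> m R" if "R \<in> E" "f \<in> B" for R f
  proof -
    obtain K where K: "\<forall>f\<in>B. \<bar>R f\<bar> \<le> K" using Ebdd[OF \<open>R \<in> E\<close>] by blast
    have "bdd_above (R ` B)" using K by (intro bdd_aboveI[of _ K]) fastforce
    then show ?thesis unfolding m_def using that by (intro cSUP_upper) auto
  qed
  have least: "m R \<le> K" if "\<And>f. f \<in> B \<Longrightarrow> R f \<le> K" for R K
    unfolding m_def using that b0 by (intro cSUP_least) auto
  have minus: "- R \<in> E" if "R \<in> E" for R using sub that by (rule subspace_neg)
  have diff: "R - S \<in> E" if "R \<in> E" "S \<in> E" for R S using sub that by (rule subspace_diff)
  have nonneg: "0 \<le> m R" if "R \<in> E" for R using upper[OF that b0(1)] E0[OF that] by simp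
  have m0: "m 0 = 0" using least[of 0 0] nonneg[OF zero] by simp
  have hom_le: "m (r *\<^sub>R R) \<le> r * m R" if "R \<in> E" "r > 0" for R r
    using upper[OF that(1)] that(2) by (intro least) simp
  have hom: "m (r *\<^sub>R R) = r * m R" if "R \<in> E" "r > 0" for R r
  proof (rule antisym[OF hom_le[OF that]])
    have "m R \<le> inverse r * m (r *\<^sub>R R)"
      using hom_le[OF scale[OF that(1), of r], of "inverse r"] that by simp
    then show "r * m R \<le> m (r *\<^sub>R R)" using that by (simp add: field_simps)
  qed
  have sym_upper: "\<bar>R f\<bar> \<le> symmetrization m R" if "R \<in> E" "f \<in> B" for R f
    using upper[OF that] upper[OF minus[OF that(1)] that(2)] nonneg[OF that(1)]
      nonneg[OF minus[OF that(1)]]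
    unfolding symmetrization_def by (simp add: fun_Compl_def)
  have sym_least: "symmetrization m R \<le> 2 * K" if "\<And>f. f \<in> B \<Longrightarrow> \<bar>R f\<bar> \<le> K" for R K
  proof -
    have "m R \<le> K" using that by (intro least) (simp add: abs_le_iff)
    moreover have "m (- R) \<le> K" using that by (intro least) (simp add: abs_le_iff)
    ultimately show ?thesis by (simp add: symmetrization_def)
  qed
  have "asym_normed_space E m"
    unfolding asym_normed_space_def
  proof (intro conjI ballI allI impI disjI2)
    fix R S assume RS: "R \<in> E" "S \<in> E"
    show "m (R + S) \<le> m R + m S"
      using upper[OF RS(1)] upper[OF RS(2)] by (intro least) (simp add: add_mono)
  next
    fix R assume R: "R \<in> E"
    show "R = 0 \<longleftrightarrow> m R = 0 \<and> m (- R) = 0"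
    proof
      assume "m R = 0 \<and> m (- R) = 0"
      then have "R f = 0" for f
        using sym_upper[OF R, of f] outside[OF R, of f]
        by (cases "f \<in> B") (auto simp: symmetrization_def)
      then show "R = 0" by (simp add: fun_eq_iff)
    qed (simp add: m0)
  qed (use sub nonneg hom in auto)
  moreover have "complete_space_on E (symmetrization m)"
    unfolding complete_space_on_def
  proof (intro allI impI, elim conjE)
    fix X :: "nat \<Rightarrow> 's \<Rightarrow> real"
    assume X: "\<forall>k. X k \<in> E"
      and C: "\<forall>e>0. \<exists>N. \<forall>j\<ge>N. \<forall>k\<ge>N. symmetrization m (X j - X k) < e"
    have unif: "\<exists>N. \<forall>j\<ge>N. \<forall>k\<ge>N. \<forall>f\<in>B. \<bar>X j f - X k f\<bar> < e" if e: "e > 0" for e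
    proof -
      obtain N where N: "\<forall>j\<ge>N. \<forall>k\<ge>N. symmetrization m (X j - X k) < e" using C e by blast
      have "\<bar>X j f - X k f\<bar> < e" if "j \<ge> N" "k \<ge> N" "f \<in> B" for j k f
        using sym_upper[OF diff, of "X j" "X k" f] X that(3) N[rule_format, OF that(1,2)] by simp
      then show ?thesis by blast
    qed
    have "convergent (\<lambda>k. X k f)" if "f \<in> B" for f
      using unif that by (intro Cauchy_convergent metric_CauchyI) (auto simp: dist_real_def, blast)
    then have "\<exists>l. \<forall>f\<in>B. (\<lambda>k. X k f) \<longlonglongrightarrow> l f"
      by (intro bchoice) (auto simp: convergent_def)
    then obtain l where l: "\<And>f. f \<in> B \<Longrightarrow> (\<lambda>k. X k f) \<longlonglongrightarrow> l f" by blast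
    define L where "L = i l"
    have lim: "\<exists>N. \<forall>k\<ge>N. \<forall>f\<in>B. \<bar>X k f - L f\<bar> \<le> e" if "e > 0" for e
    proof -
      obtain N where N: "\<forall>j\<ge>N. \<forall>k\<ge>N. \<forall>f\<in>B. \<bar>X j f - X k f\<bar> < e"
        using unif \<open>e > 0\<close> by blast
      have "\<bar>X k f - L f\<bar> \<le> e" if "k \<ge> N" "f \<in> B" for k f
      proof (rule tendsto_upperbound)
        show "(\<lambda>j. \<bar>X k f - X j f\<bar>) \<longlonglongrightarrow> \<bar>X k f - L f\<bar>"
          using l that by (auto simp: L_def i_def intro!: tendsto_intros)
        show "\<forall>\<^sub>F j in sequentially. \<bar>X k f - X j f\<bar> \<le> e"
          using N that by (auto simp: eventually_sequentially intro!: exI[of _ N] less_imp_le)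
      qed simp
      then show ?thesis by blast
    qed
    have LE: "L \<in> E"
      unfolding E_def
    proof safe
      fix f assume "f \<notin> B" then show "L f = 0" by (simp add: L_def i_def)
    next
      fix e :: real assume "e > 0"
      then obtain N where N: "\<forall>k\<ge>N. \<forall>f\<in>B. \<bar>X k f - L f\<bar> \<le> e / 2"
        using lim[of "e / 2"] by auto
      obtain Q where Q: "Q \<in> V" "\<forall>f\<in>B. \<bar>X N f - Q f\<bar> \<le> e / 2"
        using approx[of "X N" "e / 2"] X \<open>e > 0\<close> by auto
      have "\<bar>L f - Q f\<bar> \<le> e" if "f \<in> B" for f
        using N[rule_format, OF order_refl that] bspec[OF Q(2) that] by linarith
      then show "\<exists>Q\<in>V. \<forall>f\<in>B. \<bar>L f - Q f\<bar> \<le> e" using Q by blast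
    qed
    have "(\<lambda>k. symmetrization m (X k - L)) \<longlonglongrightarrow> 0"
    proof (rule LIMSEQ_I)
      fix e :: real assume "e > 0"
      then obtain N where N: "\<forall>k\<ge>N. \<forall>f\<in>B. \<bar>X k f - L f\<bar> \<le> e / 3"
        using lim[of "e / 3"] by auto
      have "norm (symmetrization m (X k - L) - 0) < e" if "k \<ge> N" for k
      proof -
        have "symmetrization m (X k - L) \<le> 2 * (e / 3)"
          using N that by (intro sym_least) simp
        moreover have "0 \<le> symmetrization m (X k - L)"
          using sym_upper[OF diff[of "X k" L] b0(1)] X LE by (meson abs_ge_zero order_trans)
        ultimately show ?thesis using \<open>e > 0\<close> by simp
      qed
      then show "\<exists>N. \<forall>k\<ge>N. norm (symmetrization m (X k - L) - 0) < e" by blast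
    qed
    with LE show "\<exists>L\<in>E. (\<lambda>k. symmetrization m (X k - L)) \<longlonglongrightarrow> 0" by blast
  qed
  moreover have "linear_map_on V E i"
    using iE by (auto simp: linear_map_on_def i_def fun_eq_iff)
  moreover have "m (i Q) = (SUP f\<in>B. Q f)" for Q
    unfolding m_def by (intro SUP_cong) (auto simp: i_def)
  moreover have "\<exists>Q\<in>V. symmetrization m (R - i Q) < e" if R: "R \<in> E" "e > 0" for R e
  proof -
    obtain Q where Q: "Q \<in> V" "\<forall>f\<in>B. \<bar>R f - Q f\<bar> \<le> e / 3"
      using approx[OF R(1), of "e / 3"] R by auto
    then have "symmetrization m (R - i Q) \<le> 2 * (e / 3)"
      by (intro sym_least) (simp add: i_def)
    then show ?thesis using Q R by (intro bexI[of _ Q]) auto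
  qed
  ultimately have "is_bicompletion V (\<lambda>Q. SUP f\<in>B. Q f) E m"
    unfolding is_bicompletion_def by blast
  then show ?thesis by blast
qed

lemma semi_lipschitz_free_exists:
  fixes d :: "'a::pointed_metric_space \<Rightarrow> 'a \<Rightarrow> real"
  assumes d: "\<And>x y. 0 \<le> d x y"
  shows "\<exists>(E :: (('a \<Rightarrow> real) \<Rightarrow> real) set) n. is_semi_lipschitz_free d E n"
proof -
  let ?B = "{f \<in> SLip0 d. slip_norm d f \<le> 1}"
  let ?A = "\<lambda>f. {C. C > 0 \<and> (\<forall>x y. f x - f y \<le> C * d y x)}"
  have bdd: "bdd_below (?A f)" for f :: "'a \<Rightarrow> real"
    by (intro bdd_belowI[of _ 0]) auto
  have S0: "(\<lambda>_. 0) \<in> SLip0 d"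
    using d by (auto simp: SLip0_def intro!: exI[of _ 1])
  have "slip_norm d (\<lambda>_. 0) \<le> 1"
    unfolding slip_norm_def using d by (intro cInf_lower bdd) auto
  with S0 have B0: "(\<lambda>_. 0) \<in> ?B" by simp
  have "\<bar>f x\<bar> \<le> 2 * (d basepoint x + d x basepoint)" if "f \<in> ?B" for f x
  proof -
    have A: "?A f \<noteq> {}" "Inf (?A f) < 2" using that by (auto simp: SLip0_def slip_norm_def)
    obtain C where C: "C \<in> ?A f" "C < 2" using cInf_lessD[OF A] by blast
    have "f x - f basepoint \<le> C * d basepoint x" "f basepoint - f x \<le> C * d x basepoint"
      using C by auto
    moreover have "C * d basepoint x \<le> 2 * d basepoint x" "C * d x basepoint \<le> 2 * d x basepoint"
      using C d by (auto intro!: mult_right_mono)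
    moreover have "f basepoint = 0" using that by (simp add: SLip0_def)
    ultimately show ?thesis
      using d[of x basepoint] d[of basepoint x] unfolding abs_le_iff distrib_left by linarith
  qed
  then have base: "\<exists>K. \<forall>f\<in>?B. \<bar>slip_delta d x f\<bar> \<le> K" for x
    by (intro exI[of _ "2 * (d basepoint x + d x basepoint)"]) (simp add: slip_delta_def)
  have Bdd: "\<exists>K. \<forall>f\<in>?B. \<bar>Q f\<bar> \<le> K" if "Q \<in> span (range (slip_delta d))" for Q
    using that
  proof (induction rule: span_induct_alt)
    case base
    show ?case by (intro exI[of _ 0]) simp
  next
    case (step c R S)
    then obtain x where x: "R = slip_delta d x" by blast
    obtain K where K: "\<forall>f\<in>?B. \<bar>R f\<bar> \<le> K" using base x by blast
    obtain M where M: "\<forall>f\<in>?B. \<bar>S f\<bar> \<le> M" using step by blast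
    have "\<bar>(c *\<^sub>R R + S) f\<bar> \<le> \<bar>c\<bar> * K + M" if "f \<in> ?B" for f
    proof -
      have "\<bar>(c *\<^sub>R R + S) f\<bar> \<le> \<bar>c\<bar> * \<bar>R f\<bar> + \<bar>S f\<bar>"
        by (simp add: abs_mult[symmetric] abs_triangle_ineq)
      also have "\<dots> \<le> \<bar>c\<bar> * K + M"
        using bspec[OF K that] bspec[OF M that] by (intro add_mono mult_left_mono) auto
      finally show ?thesis .
    qed
    then show ?case by blast
  qed
  have at0: "Q (\<lambda>_. 0) = 0" if "Q \<in> span (range (slip_delta d))" for Q
    using that by (induction rule: span_induct_alt) (auto simp: slip_delta_def)
  have "\<exists>(E :: (('a \<Rightarrow> real) \<Rightarrow> real) set) n.
      is_bicompletion (span (range (slip_delta d))) (\<lambda>Q. SUP f\<in>?B. Q f) E n"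
    using B0 at0 Bdd by (rule sup_norm_bicompletion_exists[OF subspace_span])
  moreover have "slip_dual_norm d = (\<lambda>Q. SUP f\<in>?B. Q f)"
    by (simp add: fun_eq_iff slip_dual_norm_def)
  ultimately show ?thesis by (simp add: is_semi_lipschitz_free_def)
qed

end

theory Submission
  imports Defs
begin

text \<open>
  Both statements compare unit balls of functions. Write \<open>c Q\<close> for the supremum of a functional \<open>Q\<close>
  over the functions in \<open>P\<close> of Lipschitz norm at most \<open>1\<close>. Clearly \<open>c Q \<le> \<parallel>Q\<parallel>\<close>; conversely, splitting
  a function of norm at most \<open>1\<close> as \<open>\<phi>\<^sub>1 - \<phi>\<^sub>2\<close> with both parts in \<open>P\<close> and of norm at most \<open>1\<close> gives
  \<open>Q \<phi> = Q \<phi>\<^sub>1 + (- Q) \<phi>\<^sub>2 \<le> c Q + c (- Q)\<close>. So the symmetrization of \<open>c\<close> lies between the dual norm and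
  twice the dual norm, and the identity is the first isomorphism (\<open>norm_le_symmetrization_cone_norm\<close>).

  For the second, let \<open>d\<close> be the asymmetrized distance. A function in \<open>P\<close> of Lipschitz norm at most
  \<open>1\<close> is semi-Lipschitz with constant \<open>1\<close> for \<open>d\<close>, by the very definition of \<open>d\<close>; and since \<open>d\<close> is at
  most the metric, a function that is semi-Lipschitz with constant \<open>1\<close> for \<open>d\<close> has Lipschitz norm at
  most \<open>1\<close>. The semi-Lipschitz unit ball thus lies between the unit ball of \<open>P\<close> and that of
  \<open>Lip\<^sub>0\<close>. Restricting functionals from \<open>Lip\<^sub>0\<close> to the semi-Lipschitz functions carries the span
  of the evaluations linearly onto the span of the evaluations there, and by the two inclusions the
  symmetrized semi-Lipschitz norm of the restriction again lies between the dual norm and twice it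
  (\<open>norm_le_symmetrization_restrict\<close>, \<open>symmetrization_restrict_le\<close>). The isomorphism between the
  spans extends to their completions (\<open>normed_isomorphic_closure\<close>), which are the bicompletion on
  one side and the closure in the Banach space of functionals on the other.
\<close>

section \<open>Symmetrized norms and extension of isomorphisms to completions\<close>

lemma normed_space_on_symmetrization:
  assumes "asym_normed_space E n"
  shows "normed_space_on E (symmetrization n)"
proof -
  have E: "subspace E" and nonneg: "\<And>x. x \<in> E \<Longrightarrow> 0 \<le> n x"
    and add: "\<And>x y. x \<in> E \<Longrightarrow> y \<in> E \<Longrightarrow> n (x + y) \<le> n x + n y"
    and scale: "\<And>x r. x \<in> E \<Longrightarrow> 0 < r \<Longrightarrow> n (r *\<^sub>R x) = r * n x"
    and zero: "(\<forall>x\<in>E. x = 0 \<longleftrightarrow> n x = 0) \<or> (\<forall>x\<in>E. x = 0 \<longleftrightarrow> n x = 0 \<and> n (- x) = 0)"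
    using assms by (simp_all add: asym_normed_space_def)
  have minus: "- x \<in> E" if "x \<in> E" for x
    using E that by (rule subspace_neg)
  have n0: "n 0 = 0"
    using zero subspace_0[OF E] by auto
  show ?thesis
    unfolding normed_space_on_def
  proof (intro conjI ballI allI)
    fix x assume x: "x \<in> E"
    show "0 \<le> symmetrization n x"
      using nonneg x minus[OF x] by (simp add: symmetrization_def)
    have "symmetrization n x = 0 \<longleftrightarrow> n x = 0 \<and> n (- x) = 0"
      using nonneg[OF x] nonneg[OF minus[OF x]] by (auto simp: symmetrization_def)
    also have "\<dots> \<longleftrightarrow> x = 0"
    proof
      show "x = 0" if "n x = 0 \<and> n (- x) = 0" using zero x that by blast
    qed (simp add: n0)
    finally show "symmetrization n x = 0 \<longleftrightarrow> x = 0" .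
    show "symmetrization n (r *\<^sub>R x) = \<bar>r\<bar> * symmetrization n x" for r
    proof (cases r "0 :: real" rule: linorder_cases)
      case less
      have "n (r *\<^sub>R x) = - r * n (- x)" "n (- (r *\<^sub>R x)) = - r * n x"
        using scale[OF minus[OF x], of "- r"] scale[OF x, of "- r"] less by simp_all
      then show ?thesis
        using less by (simp add: symmetrization_def algebra_simps)
    next
      case equal
      then show ?thesis by (simp add: symmetrization_def n0)
    next
      case greater
      have "n (- (r *\<^sub>R x)) = r * n (- x)"
        using scale[OF minus[OF x] greater] by simp
      then show ?thesis
        using greater scale[OF x greater] by (simp add: symmetrization_def algebra_simps)
    qed
  next
    fix x y assume xy: "x \<in> E" "y \<in> E"
    have "n (x + y) \<le> n x + n y" "n (- x + - y) \<le> n (- x) + n (- y)"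
      by (intro add minus xy)+
    then show "symmetrization n (x + y) \<le> symmetrization n x + symmetrization n y"
      by (simp add: symmetrization_def)
  qed (rule E)
qed

lemma normed_space_on_norm: "subspace E \<Longrightarrow> normed_space_on E norm"
  by (auto simp: normed_space_on_def norm_triangle_ineq)

lemma subspace_closure:
  fixes V :: "'v::real_normed_vector set"
  assumes V: "subspace V"
  shows "subspace (closure V)"
  unfolding subspace_def
proof (intro conjI ballI allI)
  show "0 \<in> closure V"
    using subspace_0[OF V] closure_subset by blast
next
  fix x y assume "x \<in> closure V" "y \<in> closure V"
  then obtain a b where "\<forall>k. a k \<in> V" "a \<longlonglongrightarrow> x" "\<forall>k. b k \<in> V" "b \<longlonglongrightarrow> y"
    unfolding closure_sequential by blast
  then show "x + y \<in> closure V"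
    unfolding closure_sequential
    by (intro exI[of _ "\<lambda>k. a k + b k"] conjI allI subspace_add[OF V] tendsto_add) auto
next
  fix x and c :: real assume "x \<in> closure V"
  then obtain a where "\<forall>k. a k \<in> V" "a \<longlonglongrightarrow> x"
    unfolding closure_sequential by blast
  then show "c *\<^sub>R x \<in> closure V"
    unfolding closure_sequential
    by (intro exI[of _ "\<lambda>k. c *\<^sub>R a k"] conjI allI subspace_scale[OF V] tendsto_scaleR tendsto_const)
      auto
qed

lemma linear_map_on_diff:
  assumes "linear_map_on V E J" "subspace V" "x \<in> V" "y \<in> V"
  shows "J (x - y) = J x - J y"
proof -
  have "J (x + (- 1) *\<^sub>R y) = J x + J ((- 1) *\<^sub>R y)"
    using assms subspace_scale[of V y "- 1"] unfolding linear_map_on_def by blast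
  moreover have "J ((- 1) *\<^sub>R y) = (- 1) *\<^sub>R J y"
    using assms unfolding linear_map_on_def by blast
  ultimately show ?thesis by simp
qed

text \<open>The extension is built as a relation: \<open>y\<close> and \<open>L\<close> correspond when points of \<open>V\<close> come close to
  \<open>L\<close> while their images come close to \<open>y\<close>. This relation is linear and respects both norm
  estimates, hence is a partial isomorphism in either direction; density of the image with
  completeness of the ambient space makes it total, and completeness of \<open>E\<close> makes it onto.\<close>

lemma normed_isomorphic_closure:
  fixes V :: "'v::banach set" and E :: "'w::real_vector set"
  assumes V: "subspace V" and E: "normed_space_on E m" and complete: "complete_space_on E m"
    and J: "linear_map_on V E J"
    and lower: "\<And>x. x \<in> V \<Longrightarrow> norm x \<le> m (J x)"
    and upper: "\<And>x. x \<in> V \<Longrightarrow> m (J x) \<le> K * norm x"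
    and dense: "\<And>y e. y \<in> E \<Longrightarrow> e > 0 \<Longrightarrow> \<exists>x\<in>V. m (y - J x) < e"
  shows "normed_isomorphic E m (closure V) norm"
proof -
  have sub: "subspace E" and m_nonneg: "\<And>x. x \<in> E \<Longrightarrow> 0 \<le> m x"
    and m_eq_0: "\<And>x. x \<in> E \<Longrightarrow> m x = 0 \<longleftrightarrow> x = 0"
    and m_add: "\<And>x y. x \<in> E \<Longrightarrow> y \<in> E \<Longrightarrow> m (x + y) \<le> m x + m y"
    and m_scale: "\<And>x r. x \<in> E \<Longrightarrow> m (r *\<^sub>R x) = \<bar>r\<bar> * m x"
    using E by (simp_all add: normed_space_on_def)
  have JE: "J x \<in> E" if "x \<in> V" for x
    using J that unfolding linear_map_on_def by blast
  have J_add: "J (x + y) = J x + J y" if "x \<in> V" "y \<in> V" for x y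
    using J that unfolding linear_map_on_def by blast
  have J_scale: "J (r *\<^sub>R x) = r *\<^sub>R J x" if "x \<in> V" for x r
    using J that unfolding linear_map_on_def by blast
  note J_diff = linear_map_on_diff[OF J V]
  note diff = subspace_diff[OF sub]
  have m_commute: "m (x - y) = m (y - x)" if "x \<in> E" "y \<in> E" for x y
    using m_scale[OF diff[OF that], of "- 1"] by simp
  have m_triangle: "m (x - z) \<le> m (x - y) + m (y - z)" if "x \<in> E" "y \<in> E" "z \<in> E" for x y z
    using m_add[OF diff[OF that(1,2)] diff[OF that(2,3)]] by simp
  have closure: "subspace (closure V)"
    using V by (rule subspace_closure)
  (* K may be negative when V is trivial, but the estimates below multiply inequalities by it *)
  have upper': "m (J x) \<le> max K 0 * norm x" if "x \<in> V" for x
    using upper[OF that] mult_right_mono[of K "max K 0" "norm x"] by simp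

  (* existence of approximations at every scale, rather than one sequence, keeps R free of choices *)
  define R where "R y L \<longleftrightarrow> y \<in> E \<and> L \<in> closure V \<and>
    (\<forall>e>0. \<exists>x\<in>V. m (y - J x) < e \<and> norm (L - x) < e)" for y L
  have R_approx: "\<exists>x\<in>V. m (y - J x) < e \<and> norm (L - x) < e" if "R y L" "e > 0" for y L e
    using that unfolding R_def by blast
  have R_add: "R (y + z) (L + M)" if R: "R y L" "R z M" for y z L M
    unfolding R_def
  proof (intro conjI allI impI)
    fix e :: real assume "e > 0"
    then have "e / 2 > 0" by simp
    then obtain x where x: "x \<in> V" "m (y - J x) < e / 2" "norm (L - x) < e / 2"
      using R_approx[OF R(1)] by blast
    obtain w where w: "w \<in> V" "m (z - J w) < e / 2" "norm (M - w) < e / 2"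
      using R_approx[OF R(2) \<open>e / 2 > 0\<close>] by blast
    have E': "y - J x \<in> E" "z - J w \<in> E"
      using that x w JE diff unfolding R_def by auto
    have "m (y + z - J (x + w)) = m ((y - J x) + (z - J w))"
      using x w by (simp add: J_add algebra_simps)
    then have "m (y + z - J (x + w)) < e"
      using m_add[OF E'] x(2) w(2) by linarith
    moreover have "norm (L + M - (x + w)) < e"
      using norm_triangle_ineq[of "L - x" "M - w"] x w by (simp add: algebra_simps)
    ultimately show "\<exists>x\<in>V. m (y + z - J x) < e \<and> norm (L + M - x) < e"
      using x w V subspace_add by blast
  qed (use that sub closure subspace_add in \<open>auto simp: R_def\<close>)
  have R_scale: "R (r *\<^sub>R y) (r *\<^sub>R L)" if R: "R y L" for y L r
    unfolding R_def
  proof (intro conjI allI impI)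
    fix e :: real assume "e > 0"
    then have "e / (\<bar>r\<bar> + 1) > 0" by simp
    then obtain x where x: "x \<in> V" "m (y - J x) < e / (\<bar>r\<bar> + 1)" "norm (L - x) < e / (\<bar>r\<bar> + 1)"
      using R_approx[OF R] by blast
    have small: "\<bar>r\<bar> * t < e" if t: "0 \<le> t" "t < e / (\<bar>r\<bar> + 1)" for t
    proof -
      have "\<bar>r\<bar> * t \<le> (\<bar>r\<bar> + 1) * t" using t by (intro mult_right_mono) auto
      also have "\<dots> < e" using t by (simp add: field_simps)
      finally show ?thesis .
    qed
    have E': "y - J x \<in> E"
      using that x JE diff unfolding R_def by auto
    have "m (r *\<^sub>R y - J (r *\<^sub>R x)) = m (r *\<^sub>R (y - J x))"
      using x by (simp add: J_scale scaleR_diff_right)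
    then have "m (r *\<^sub>R y - J (r *\<^sub>R x)) < e"
      using small[OF m_nonneg[OF E'] x(2)] m_scale[OF E', of r] by linarith
    moreover have "norm (r *\<^sub>R L - r *\<^sub>R x) < e"
      using small[OF norm_ge_zero x(3)] by (simp flip: scaleR_diff_right)
    ultimately show "\<exists>x\<in>V. m (r *\<^sub>R y - J x) < e \<and> norm (r *\<^sub>R L - x) < e"
      using x V subspace_scale by blast
  qed (use that sub closure subspace_scale in \<open>auto simp: R_def\<close>)
  have R_lower: "norm L \<le> m y" if R: "R y L" for y L
  proof (rule field_le_epsilon)
    fix e :: real assume "e > 0"
    then have "e / 2 > 0" by simp
    then obtain x where x: "x \<in> V" "m (y - J x) < e / 2" "norm (L - x) < e / 2"
      using R_approx[OF R] by blast
    have yE: "y \<in> E" using that by (simp add: R_def)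
    have "norm L \<le> norm (L - x) + norm x"
      using norm_triangle_ineq[of "L - x" x] by simp
    moreover have "m (J x) \<le> m (J x - y) + m y"
      using m_add[OF diff[OF JE[OF x(1)] yE] yE] by simp
    ultimately show "norm L \<le> m y + e"
      using lower[OF x(1)] x m_commute[OF JE[OF x(1)] yE] by simp
  qed
  have R_upper: "m y \<le> max K 0 * norm L" if R: "R y L" for y L
  proof (rule field_le_epsilon)
    fix e :: real assume "e > 0"
    define h where "h = e / (max K 0 + 1)"
    have "h > 0" using \<open>e > 0\<close> by (simp add: h_def add_nonneg_pos)
    then obtain x where x: "x \<in> V" "m (y - J x) < h" "norm (L - x) < h"
      using R_approx[OF R] by blast
    have yE: "y \<in> E" using that by (simp add: R_def)
    have "m y \<le> m (y - J x) + m (J x)"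
      using m_add[OF diff[OF yE JE[OF x(1)]] JE[OF x(1)]] by simp
    also have "\<dots> \<le> h + max K 0 * (norm L + h)"
    proof (intro add_mono order_trans[OF upper'[OF x(1)]] mult_left_mono)
      show "norm x \<le> norm L + h"
        using norm_triangle_sub[of x L] x(3) by (simp add: norm_minus_commute)
    qed (use x in auto)
    also have "\<dots> = max K 0 * norm L + h * (max K 0 + 1)"
      by (simp add: algebra_simps)
    also have "h * (max K 0 + 1) = e"
      unfolding h_def by (simp add: max_def)
    finally show "m y \<le> max K 0 * norm L + e" .
  qed
  have R_diff: "R (y - z) (L - M)" if "R y L" "R z M" for y z L M
    using R_add[OF that(1) R_scale[OF that(2), of "- 1"]] by simp
  have R_fun: "L = M" if "R y L" "R y M" for y L M
    using R_lower[OF R_diff[OF that]] m_eq_0[OF subspace_0[OF sub]] by simp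
  have R_inj: "y = z" if "R y L" "R z L" for y z L
  proof -
    have "m (y - z) \<le> 0" using R_upper[OF R_diff[OF that]] by simp
    moreover have "y - z \<in> E" using that diff by (auto simp: R_def)
    ultimately show ?thesis using m_nonneg m_eq_0 by fastforce
  qed
  have R_limit: "R y L" if x: "\<And>k. x k \<in> V" and y: "y \<in> E" "(\<lambda>k. m (y - J (x k))) \<longlonglongrightarrow> 0"
    and L: "x \<longlonglongrightarrow> L" for x :: "nat \<Rightarrow> 'v" and y L
    unfolding R_def
  proof (intro conjI allI impI)
    show "L \<in> closure V" using x L closure_sequential by blast
    fix e :: real assume "e > 0"
    have "\<forall>\<^sub>F k in sequentially. m (y - J (x k)) < e"
      using order_tendstoD(2)[OF y(2) \<open>e > 0\<close>] .
    moreover have "\<forall>\<^sub>F k in sequentially. norm (L - x k) < e"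
      using tendstoD[OF L \<open>e > 0\<close>] by (simp add: dist_norm norm_minus_commute)
    ultimately have "\<forall>\<^sub>F k in sequentially. m (y - J (x k)) < e \<and> norm (L - x k) < e"
      by (rule eventually_conj)
    then obtain k where "m (y - J (x k)) < e \<and> norm (L - x k) < e"
      using eventually_happens'[OF sequentially_bot] by blast
    with x show "\<exists>x\<in>V. m (y - J x) < e \<and> norm (L - x) < e"
      by blast
  qed (rule y)
  have R_total: "\<exists>L. R y L" if y: "y \<in> E" for y
  proof -
    have "\<forall>k. \<exists>x\<in>V. m (y - J x) < inverse (real (Suc k))"
      by (intro allI dense[OF y]) simp
    then obtain x where x: "\<And>k. x k \<in> V" "\<And>k. m (y - J (x k)) < inverse (real (Suc k))"
      by metis
    have "(\<lambda>k. m (y - J (x k))) \<longlonglongrightarrow> 0"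
      using x m_nonneg[OF diff[OF y JE[OF x(1)]]]
      by (intro tendsto_sandwich[OF _ _ tendsto_const LIMSEQ_inverse_real_of_nat])
        (auto intro!: always_eventually less_imp_le)
    moreover have "Cauchy x"
    proof (rule CauchyI)
      fix e :: real assume "e > 0"
      then obtain N where N: "\<forall>k\<ge>N. m (y - J (x k)) < e / 2"
        using order_tendstoD(2)[OF calculation, of "e / 2"] by (auto simp: eventually_sequentially)
      have "norm (x j - x k) < e" if "j \<ge> N" "k \<ge> N" for j k
      proof -
        have "norm (x j - x k) \<le> m (J (x j) - J (x k))"
          using lower[OF subspace_diff[OF V]] x(1) J_diff by metis
        also have "\<dots> \<le> m (J (x j) - y) + m (y - J (x k))"
          by (intro m_triangle JE x y)
        finally show ?thesis
          using N[rule_format, OF that(1)] N[rule_format, OF that(2)] m_commute[OF JE y] x(1)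
          by (metis add_strict_mono field_sum_of_halves le_less_trans)
      qed
      then show "\<exists>N. \<forall>j\<ge>N. \<forall>k\<ge>N. norm (x j - x k) < e" by blast
    qed
    then obtain L where "x \<longlonglongrightarrow> L" using Cauchy_convergent convergent_def by blast
    ultimately show ?thesis using R_limit[of x y L] x y by blast
  qed
  have R_onto: "\<exists>y. R y L" if L: "L \<in> closure V" for L
  proof -
    obtain x where x: "\<And>k. x k \<in> V" and lim: "x \<longlonglongrightarrow> L"
      using L closure_sequential by blast
    have "\<exists>N. \<forall>j\<ge>N. \<forall>k\<ge>N. m (J (x j) - J (x k)) < e" if "e > 0" for e
    proof -
      have pos: "max K 0 + 1 > 0" by (simp add: add_nonneg_pos)
      obtain N where N: "\<forall>j\<ge>N. \<forall>k\<ge>N. norm (x j - x k) < e / (max K 0 + 1)"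
        using LIMSEQ_imp_Cauchy[OF lim] pos \<open>e > 0\<close> CauchyD divide_pos_pos by metis
      have "m (J (x j) - J (x k)) < e" if "j \<ge> N" "k \<ge> N" for j k
      proof -
        have "m (J (x j) - J (x k)) \<le> max K 0 * norm (x j - x k)"
          using upper'[OF subspace_diff[OF V]] x J_diff by metis
        also have "\<dots> \<le> (max K 0 + 1) * norm (x j - x k)"
          by (intro mult_right_mono) auto
        also have "\<dots> < e"
          using N[rule_format, OF that] pos by (simp add: field_simps)
        finally show ?thesis .
      qed
      then show ?thesis by blast
    qed
    moreover have "J (x k) \<in> E" for k by (intro JE x)
    ultimately obtain y where y: "y \<in> E" "(\<lambda>k. m (J (x k) - y)) \<longlonglongrightarrow> 0"
      using complete[unfolded complete_space_on_def, rule_format, of "\<lambda>k. J (x k)"] by blast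
    then have "(\<lambda>k. m (y - J (x k))) \<longlonglongrightarrow> 0"
      using m_commute[OF JE[OF x] y(1)] by simp
    then show ?thesis using R_limit[of x y L] x y lim by blast
  qed

  define f where "f y = (SOME L. R y L)" for y
  have Rf: "R y (f y)" if "y \<in> E" for y
    unfolding f_def using R_total[OF that] by (rule someI_ex)
  have f_eq: "f y = L" if "R y L" for y L
    using R_fun[OF Rf that] that by (simp add: R_def)
  have "linear_map_on E (closure V) f"
    unfolding linear_map_on_def
  proof (intro conjI ballI allI)
    show "f ` E \<subseteq> closure V" using Rf by (auto simp: R_def)
    show "f (x + y) = f x + f y" if "x \<in> E" "y \<in> E" for x y
      by (intro f_eq R_add Rf that)
    show "f (r *\<^sub>R x) = r *\<^sub>R f x" if "x \<in> E" for x r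
      by (intro f_eq R_scale Rf that)
  qed
  moreover have bij: "bij_betw f E (closure V)"
    unfolding bij_betw_def
  proof
    show "inj_on f E" using Rf R_inj by (metis inj_onI)
    show "f ` E = closure V"
    proof
      show "f ` E \<subseteq> closure V" using Rf by (auto simp: R_def)
      show "closure V \<subseteq> f ` E"
      proof
        fix L assume "L \<in> closure V"
        then obtain y where y: "R y L" using R_onto by blast
        then have "y \<in> E" by (simp add: R_def)
        then show "L \<in> f ` E" using f_eq[OF y] by blast
      qed
    qed
  qed
  moreover have "norm (f y) \<le> 1 * m y" if "y \<in> E" for y
    using R_lower[OF Rf[OF that]] by simp
  moreover have "m (inv_into E f L) \<le> max K 0 * norm L" if "L \<in> closure V" for L
  proof -
    have L: "L \<in> f ` E" using bij that by (simp add: bij_betw_def)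
    show ?thesis
      using R_upper[OF Rf[OF inv_into_into[OF L]]] f_inv_into_f[OF L] by simp
  qed
  ultimately show ?thesis
    unfolding normed_isomorphic_def using E normed_space_on_norm[OF closure] by blast
qed

section \<open>The asymmetric norm of a cone\<close>

lemma cone_norm_upper:
  assumes "\<phi> \<in> P" "norm \<phi> \<le> 1"
  shows "blinfun_apply Q \<phi> \<le> cone_norm P Q"
  unfolding cone_norm_def
proof (rule cSUP_upper)
  show "bdd_above (blinfun_apply Q ` {\<phi> \<in> P. norm \<phi> \<le> 1})"
  proof (rule bdd_aboveI2)
    fix \<psi> assume "\<psi> \<in> {\<phi> \<in> P. norm \<phi> \<le> 1}"
    then have "norm Q * norm \<psi> \<le> norm Q * 1" by (intro mult_left_mono) auto
    then show "blinfun_apply Q \<psi> \<le> norm Q" using norm_blinfun[of Q \<psi>] by simp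
  qed
qed (use assms in simp)

lemma cone_norm_least:
  assumes "0 \<in> P" "\<And>\<phi>. \<phi> \<in> P \<Longrightarrow> norm \<phi> \<le> 1 \<Longrightarrow> blinfun_apply Q \<phi> \<le> c"
  shows "cone_norm P Q \<le> c"
  unfolding cone_norm_def using assms by (intro cSUP_least) auto

lemma cone_norm_nonneg: "0 \<in> P \<Longrightarrow> 0 \<le> cone_norm P Q"
  using cone_norm_upper[of 0 P Q] by simp

lemma cone_norm_le_norm:
  assumes "0 \<in> P"
  shows "cone_norm P Q \<le> norm Q"
proof (rule cone_norm_least[OF assms])
  fix \<phi> :: "'a lip0" assume "norm \<phi> \<le> 1"
  then have "norm Q * norm \<phi> \<le> norm Q * 1" by (intro mult_left_mono) auto
  then show "blinfun_apply Q \<phi> \<le> norm Q" using norm_blinfun[of Q \<phi>] by simp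
qed

lemma cone_norm_scaleR:
  assumes "0 \<in> P" "r > 0"
  shows "cone_norm P (r *\<^sub>R Q) = r * cone_norm P Q"
proof (rule antisym)
  have le: "cone_norm P (r *\<^sub>R Q) \<le> r * cone_norm P Q" if "r > 0" for r Q
    using that by (intro cone_norm_least assms) (simp add: scaleR_blinfun.rep_eq cone_norm_upper)
  then show "cone_norm P (r *\<^sub>R Q) \<le> r * cone_norm P Q" using assms by blast
  show "r * cone_norm P Q \<le> cone_norm P (r *\<^sub>R Q)"
    using le[of "inverse r" "r *\<^sub>R Q"] assms by (simp add: field_simps)
qed

lemma cone_norm_add:
  assumes "0 \<in> P"
  shows "cone_norm P (Q + R) \<le> cone_norm P Q + cone_norm P R"
  by (intro cone_norm_least assms) (simp add: plus_blinfun.rep_eq add_mono cone_norm_upper)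

text \<open>The cone alone sees only one side of \<open>Q\<close>, but symmetrizing supplies the other: the subtracted
  part of a function in the unit ball is paired with \<open>- Q\<close>, and both parts stay in the unit ball.\<close>

lemma norm_le_symmetrization_cone_norm:
  assumes 0: "0 \<in> P"
    and decomposition: "\<And>\<phi>. \<exists>\<phi>\<^sub>1\<in>P. \<exists>\<phi>\<^sub>2\<in>P. \<phi> = \<phi>\<^sub>1 - \<phi>\<^sub>2 \<and> max (norm \<phi>\<^sub>1) (norm \<phi>\<^sub>2) \<le> norm \<phi>"
  shows "norm Q \<le> symmetrization (cone_norm P) Q"
proof -
  let ?s = "symmetrization (cone_norm P) Q"
  have ball: "blinfun_apply Q \<phi> \<le> ?s" if "norm \<phi> \<le> 1" for \<phi>
  proof -
    obtain \<phi>1 \<phi>2 where \<phi>: "\<phi>1 \<in> P" "\<phi>2 \<in> P" "\<phi> = \<phi>1 - \<phi>2" "max (norm \<phi>1) (norm \<phi>2) \<le> norm \<phi>"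
      using decomposition by blast
    have "blinfun_apply Q \<phi> = blinfun_apply Q \<phi>1 + blinfun_apply (- Q) \<phi>2"
      using \<phi> by (simp add: blinfun.diff_right uminus_blinfun.rep_eq)
    also have "\<dots> \<le> ?s"
      unfolding symmetrization_def using \<phi> that by (intro add_mono cone_norm_upper) auto
    finally show ?thesis .
  qed
  have "norm (blinfun_apply Q \<phi>) \<le> ?s * norm \<phi>" for \<phi>
  proof (cases "\<phi> = 0")
    case False
    have unit: "norm (\<phi> /\<^sub>R norm \<phi>) \<le> 1" "norm (- (\<phi> /\<^sub>R norm \<phi>)) \<le> 1"
      using False by simp_all
    have "\<bar>blinfun_apply Q (\<phi> /\<^sub>R norm \<phi>)\<bar> \<le> ?s"
      using ball[OF unit(1)] ball[OF unit(2)] by (simp add: blinfun.minus_right abs_le_iff)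
    then show ?thesis
      using False by (simp add: blinfun.scaleR_right abs_mult field_simps)
  qed simp
  moreover have "0 \<le> ?s"
    using cone_norm_nonneg[OF 0] by (simp add: symmetrization_def)
  ultimately show ?thesis by (intro norm_blinfun_bound) auto
qed

lemma symmetrization_cone_norm_le: "0 \<in> P \<Longrightarrow> symmetrization (cone_norm P) Q \<le> 2 * norm Q"
  using cone_norm_le_norm[of P Q] cone_norm_le_norm[of P "- Q"] by (simp add: symmetrization_def)

lemma asym_normed_space_cone_norm:
  assumes "0 \<in> P" "subspace E"
    and norm_le: "\<And>Q. norm Q \<le> symmetrization (cone_norm P) Q"
  shows "asym_normed_space E (cone_norm P)"
  unfolding asym_normed_space_def
proof (intro conjI ballI allI impI disjI2)
  fix Q
  have "cone_norm P 0 = 0"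
    using cone_norm_le_norm[OF assms(1), of 0] cone_norm_nonneg[OF assms(1), of 0] by simp
  then show "Q = 0 \<longleftrightarrow> cone_norm P Q = 0 \<and> cone_norm P (- Q) = 0"
    using norm_le[of Q] by (auto simp: symmetrization_def)
qed (use assms cone_norm_nonneg cone_norm_add cone_norm_scaleR in auto)

lemma subspace_lip_free: "subspace lip_free"
  unfolding lip_free_def by (intro subspace_closure subspace_span)

lemma cone_dist_nonneg: "0 \<in> P \<Longrightarrow> 0 \<le> cone_dist P x y"
  unfolding cone_dist_def by (rule cone_norm_nonneg)

lemma cone_dist_le_dist:
  assumes "0 \<in> P"
  shows "cone_dist P x y \<le> dist x y"
  unfolding cone_dist_def
proof (rule cone_norm_least[OF assms])
  fix \<phi> :: "'a lip0" assume "norm \<phi> \<le> 1"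
  then have "norm \<phi> * dist y x \<le> 1 * dist y x" by (intro mult_right_mono) auto
  then show "blinfun_apply (lip_delta y - lip_delta x) \<phi> \<le> dist x y"
    using lip0_le_norm[of \<phi> y x]
    by (simp add: minus_blinfun.rep_eq lip_delta.rep_eq dist_commute)
qed

lemma lip_apply_diff_le_cone_dist:
  assumes "\<phi> \<in> P" "norm \<phi> \<le> 1"
  shows "lip_apply \<phi> x - lip_apply \<phi> y \<le> cone_dist P y x"
  using cone_norm_upper[OF assms, of "lip_delta x - lip_delta y"]
  by (simp add: cone_dist_def minus_blinfun.rep_eq lip_delta.rep_eq)

section \<open>Restricting functionals to semi-Lipschitz functions\<close>

text \<open>The distance is dominated by the metric, so semi-Lipschitz functions are Lipschitz: exchanging
  the two points turns the one-sided estimate into a two-sided one once the bound is symmetric.\<close>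

lemma SLip0_lip_apply_Lip0:
  assumes d: "\<And>x y. d x y \<le> dist x y" and f: "f \<in> SLip0 d"
  shows "lip_apply (Lip0 f) = f"
proof (rule Lip0_inverse, safe)
  show "f basepoint = 0" using f by (simp add: SLip0_def)
  obtain C where C: "C > 0" "\<And>x y. f x - f y \<le> C * d y x"
    using f by (auto simp: SLip0_def)
  have "f x - f y \<le> C * dist x y" for x y
  proof -
    have "f x - f y \<le> C * d y x" by (rule C)
    also have "\<dots> \<le> C * dist y x" using C(1) by (intro mult_left_mono d) simp
    finally show ?thesis by (simp add: dist_commute)
  qed
  then have "\<bar>f x - f y\<bar> \<le> C * dist x y" for x y
    by (metis abs_le_iff dist_commute minus_diff_eq)
  then show "\<exists>C. C-lipschitz_on UNIV f"
    using C(1) by (intro exI[of _ C] lipschitz_onI) (auto simp: dist_real_def)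
qed

text \<open>The infimum that defines the norm of a semi-Lipschitz function is a semi-Lipschitz constant;
  here a vanishing distance has to be treated separately, as it leaves the constant free.\<close>

lemma SLip0_diff_le:
  assumes d: "\<And>x y. 0 \<le> d x y" and f: "f \<in> SLip0 d" "slip_norm d f \<le> 1"
  shows "f x - f y \<le> d y x"
proof -
  let ?A = "{C. C > 0 \<and> (\<forall>x y. f x - f y \<le> C * d y x)}"
  obtain C where C: "C \<in> ?A" using f(1) by (auto simp: SLip0_def)
  show ?thesis
  proof (cases "d y x = 0")
    case True
    have "f x - f y \<le> C * d y x" using C by blast
    with True show ?thesis by simp
  next
    case False
    then have pos: "d y x > 0" using d[of y x] by simp
    have "(f x - f y) / d y x \<le> slip_norm d f"
      unfolding slip_norm_def
    proof (rule cInf_greatest)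
      show "(f x - f y) / d y x \<le> c" if "c \<in> ?A" for c
        using that pos by (simp add: divide_le_eq)
    qed (use C in blast)
    also note f(2)
    finally show ?thesis
      using pos by (simp add: divide_le_eq)
  qed
qed

lemma norm_Lip0_le_1:
  assumes d: "\<And>x y. 0 \<le> d x y" "\<And>x y. d x y \<le> dist x y"
    and f: "f \<in> SLip0 d" "slip_norm d f \<le> 1"
  shows "norm (Lip0 f) \<le> 1"
proof (rule lip0_norm_leI)
  have le: "f x - f y \<le> dist x y" for x y
    using SLip0_diff_le[of d f x y, OF d(1) f] d(2)[of y x] by (simp add: dist_commute)
  show "\<bar>lip_apply (Lip0 f) x - lip_apply (Lip0 f) y\<bar> \<le> 1 * dist x y" for x y
    using le[of x y] le[of y x]
    by (simp add: SLip0_lip_apply_Lip0[OF d(2) f(1)] abs_le_iff dist_commute)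
qed simp

text \<open>This is the inclusion for which the distance is designed: a supremum over the unit ball of the
  cone bounds the increments of each member of that ball. At \<open>\<phi> = 0\<close> it also shows that the
  semi-Lipschitz unit ball is inhabited, so that suprema over it are meaningful.\<close>

lemma cone_unit_ball_SLip0:
  assumes "0 \<in> P" "\<phi> \<in> P" "norm \<phi> \<le> 1"
  shows "lip_apply \<phi> \<in> SLip0 (cone_dist P)" "slip_norm (cone_dist P) (lip_apply \<phi>) \<le> 1"
proof -
  let ?A = "{C. C > 0 \<and> (\<forall>x y. lip_apply \<phi> x - lip_apply \<phi> y \<le> C * cone_dist P y x)}"
  have 1: "1 \<in> ?A"
    using lip_apply_diff_le_cone_dist[OF assms(2,3)] by simp
  then show "lip_apply \<phi> \<in> SLip0 (cone_dist P)"
    by (auto simp: SLip0_def intro!: exI[of _ 1])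
  show "slip_norm (cone_dist P) (lip_apply \<phi>) \<le> 1"
    unfolding slip_norm_def using 1 by (intro cInf_lower bdd_belowI[of _ 0]) auto
qed

text \<open>The value \<open>0\<close> outside the semi-Lipschitz functions follows the convention of \<open>slip_delta\<close>, and
  it avoids the unspecified value of \<open>Lip0\<close> at functions that are not Lipschitz. Defining the
  restriction on all functionals gives linearity at once; on the span of the evaluations it would
  have to be shown independent of the chosen linear combination.\<close>

definition slip_restrict ::
  "('a::pointed_metric_space \<Rightarrow> 'a \<Rightarrow> real) \<Rightarrow> ('a lip0 \<Rightarrow>\<^sub>L real) \<Rightarrow> ('a \<Rightarrow> real) \<Rightarrow> real" where
  "slip_restrict d Q = (\<lambda>f. if f \<in> SLip0 d then blinfun_apply Q (Lip0 f) else 0)"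

lemma linear_slip_restrict: "linear (slip_restrict d)"
  by (rule linearI)
    (auto simp: slip_restrict_def fun_eq_iff plus_blinfun.rep_eq scaleR_blinfun.rep_eq)

lemma slip_restrict_lip_delta:
  assumes "\<And>x y. d x y \<le> dist x y"
  shows "slip_restrict d (lip_delta x) = slip_delta d x"
  by (auto simp: slip_restrict_def slip_delta_def fun_eq_iff lip_delta.rep_eq
      SLip0_lip_apply_Lip0[OF assms])

lemma slip_restrict_span:
  assumes "\<And>x y. d x y \<le> dist x y"
  shows "slip_restrict d ` span (range lip_delta) = span (range (slip_delta d))"
  using linear_span_image[OF linear_slip_restrict, of d "range lip_delta"]
  by (simp add: image_image slip_restrict_lip_delta[OF assms])

lemma slip_restrict_le_norm:
  assumes d: "\<And>x y. 0 \<le> d x y" "\<And>x y. d x y \<le> dist x y"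
    and f: "f \<in> SLip0 d" "slip_norm d f \<le> 1"
  shows "slip_restrict d Q f \<le> norm Q"
proof -
  have "norm Q * norm (Lip0 f) \<le> norm Q * 1"
    using norm_Lip0_le_1[of d, OF d f] by (intro mult_left_mono) auto
  then show ?thesis
    using norm_blinfun[of Q "Lip0 f"] f(1) by (simp add: slip_restrict_def)
qed

lemma slip_dual_norm_restrict_le:
  assumes 0: "0 \<in> P"
  shows "slip_dual_norm (cone_dist P) (slip_restrict (cone_dist P) Q) \<le> norm Q"
  unfolding slip_dual_norm_def
proof (rule cSUP_least)
  show "{f \<in> SLip0 (cone_dist P). slip_norm (cone_dist P) f \<le> 1} \<noteq> {}"
    using cone_unit_ball_SLip0[OF 0 0] by auto
qed (use slip_restrict_le_norm[of "cone_dist P"] cone_dist_nonneg cone_dist_le_dist 0 in blast)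

text \<open>A supremum over a larger set is larger, provided it is finite; finiteness comes from the
  inclusion of the semi-Lipschitz unit ball in that of \<open>Lip\<^sub>0\<close>.\<close>

lemma cone_norm_le_slip_dual_norm:
  assumes 0: "0 \<in> P"
  shows "cone_norm P Q \<le> slip_dual_norm (cone_dist P) (slip_restrict (cone_dist P) Q)"
proof (rule cone_norm_least[OF 0])
  fix \<phi> assume \<phi>: "\<phi> \<in> P" "norm \<phi> \<le> 1"
  let ?B = "{f \<in> SLip0 (cone_dist P). slip_norm (cone_dist P) f \<le> 1}"
  note S = cone_unit_ball_SLip0[OF 0 \<phi>]
  have "slip_restrict (cone_dist P) Q (lip_apply \<phi>) = blinfun_apply Q \<phi>"
    using S(1) by (simp add: slip_restrict_def lip_apply_inverse)
  moreover have "slip_restrict (cone_dist P) Q (lip_apply \<phi>)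
      \<le> slip_dual_norm (cone_dist P) (slip_restrict (cone_dist P) Q)"
    unfolding slip_dual_norm_def
  proof (rule cSUP_upper)
    show "bdd_above (slip_restrict (cone_dist P) Q ` ?B)"
      using slip_restrict_le_norm[of "cone_dist P"] cone_dist_nonneg cone_dist_le_dist 0
      by (intro bdd_aboveI2[of _ _ "norm Q"]) blast
  qed (use S in simp)
  ultimately show "blinfun_apply Q \<phi> \<le> slip_dual_norm (cone_dist P) (slip_restrict (cone_dist P) Q)"
    by simp
qed

lemma norm_le_symmetrization_restrict:
  assumes 0: "0 \<in> P" and norm_le: "norm Q \<le> symmetrization (cone_norm P) Q"
  shows "norm Q \<le> symmetrization (slip_dual_norm (cone_dist P)) (slip_restrict (cone_dist P) Q)"
  using norm_le cone_norm_le_slip_dual_norm[OF 0, of Q] cone_norm_le_slip_dual_norm[OF 0, of "- Q"]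
  by (simp add: symmetrization_def linear_neg[OF linear_slip_restrict])

lemma symmetrization_restrict_le:
  assumes "0 \<in> P"
  shows "symmetrization (slip_dual_norm (cone_dist P)) (slip_restrict (cone_dist P) Q) \<le> 2 * norm Q"
  using slip_dual_norm_restrict_le[OF assms, of Q] slip_dual_norm_restrict_le[OF assms, of "- Q"]
  by (simp add: symmetrization_def linear_neg[OF linear_slip_restrict])

section \<open>The two isomorphisms\<close>

theorem theorem3p12:
  fixes P :: "'a::pointed_metric_space lip0 set"
    and Fa :: "'e::real_vector set"
    and norm_Fa :: "'e \<Rightarrow> real"
  assumes cone: "convex_cone P"
    and decomposition: "\<And>\<phi>. \<exists>\<phi>\<^sub>1\<in>P. \<exists>\<phi>\<^sub>2\<in>P. \<phi> = \<phi>\<^sub>1 - \<phi>\<^sub>2 \<and>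
           max (norm \<phi>\<^sub>1) (norm \<phi>\<^sub>2) \<le> norm \<phi> \<and> norm \<phi> \<le> norm \<phi>\<^sub>1 + norm \<phi>\<^sub>2"
    and Fa: "is_semi_lipschitz_free (cone_dist P) Fa norm_Fa"
  shows "normed_isomorphic lip_free (symmetrization (cone_norm P))
           (lip_free :: ('a lip0 \<Rightarrow>\<^sub>L real) set) norm \<and>
         normed_isomorphic Fa (symmetrization norm_Fa)
           (lip_free :: ('a lip0 \<Rightarrow>\<^sub>L real) set) norm"
proof
  have 0: "0 \<in> P"
    using cone by (rule convex_cone_contains_0)
  have norm_le: "norm Q \<le> symmetrization (cone_norm P) Q" for Q
    using 0 decomposition by (intro norm_le_symmetrization_cone_norm) blast+
  show "normed_isomorphic lip_free (symmetrization (cone_norm P))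
      (lip_free :: ('a lip0 \<Rightarrow>\<^sub>L real) set) norm"
    unfolding normed_isomorphic_def
  proof (intro conjI exI[of _ id])
    show "normed_space_on lip_free (symmetrization (cone_norm P))"
      by (intro normed_space_on_symmetrization asym_normed_space_cone_norm 0 subspace_lip_free norm_le)
    show "normed_space_on lip_free (norm :: ('a lip0 \<Rightarrow>\<^sub>L real) \<Rightarrow> real)"
      by (intro normed_space_on_norm subspace_lip_free)
    show "\<exists>C. \<forall>Q\<in>lip_free. norm (id Q) \<le> C * symmetrization (cone_norm P) Q"
      using norm_le by (intro exI[of _ 1]) simp
    have "inv_into lip_free id Q = Q" if "Q \<in> lip_free" for Q :: "'a lip0 \<Rightarrow>\<^sub>L real"
      using inv_into_f_f[of id lip_free Q] that by simp
    then show "\<exists>C. \<forall>Q\<in>lip_free. symmetrization (cone_norm P) (inv_into lip_free id Q) \<le> C * norm Q"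
      using symmetrization_cone_norm_le[OF 0] by (intro exI[of _ 2]) simp
  qed (simp_all add: linear_map_on_def)

  let ?V = "span (range lip_delta) :: ('a lip0 \<Rightarrow>\<^sub>L real) set"
  let ?d = "cone_dist P"
  let ?T = "slip_restrict ?d"
  obtain i where i: "linear_map_on (span (range (slip_delta ?d))) Fa i"
    and iso: "\<And>Q. Q \<in> span (range (slip_delta ?d)) \<Longrightarrow> norm_Fa (i Q) = slip_dual_norm ?d Q"
    and dense: "\<And>y e. y \<in> Fa \<Longrightarrow> e > 0 \<Longrightarrow>
      \<exists>Q\<in>span (range (slip_delta ?d)). symmetrization norm_Fa (y - i Q) < e"
    and asym: "asym_normed_space Fa norm_Fa"
    and complete: "complete_space_on Fa (symmetrization norm_Fa)"
    using Fa unfolding is_semi_lipschitz_free_def is_bicompletion_def by blast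
  have span: "?T ` ?V = span (range (slip_delta ?d))"
    using 0 by (intro slip_restrict_span cone_dist_le_dist)
  have T: "?T Q \<in> span (range (slip_delta ?d))" if "Q \<in> ?V" for Q
    using span that by blast
  have sym: "symmetrization norm_Fa (i (?T Q)) = symmetrization (slip_dual_norm ?d) (?T Q)"
    if "Q \<in> ?V" for Q
  proof -
    (* i is linear only on a carrier, so its values at 0 and at a negative come from differences *)
    have "- i (?T Q) = i (- ?T Q)"
      using linear_map_on_diff[OF i subspace_span span_0 T[OF that]]
        linear_map_on_diff[OF i subspace_span span_0 span_0] by simp
    then show ?thesis
      using iso T[OF that] span_neg[OF T[OF that]] by (simp add: symmetrization_def)
  qed
  have "normed_isomorphic Fa (symmetrization norm_Fa) (closure ?V) norm"
  proof (rule normed_isomorphic_closure)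
    show "linear_map_on ?V Fa (\<lambda>Q. i (?T Q))"
      using i T by (auto simp: linear_map_on_def linear_add[OF linear_slip_restrict]
          linear_scale[OF linear_slip_restrict])
    fix Q assume Q: "Q \<in> ?V"
    show "norm Q \<le> symmetrization norm_Fa (i (?T Q))"
      unfolding sym[OF Q] using 0 norm_le by (rule norm_le_symmetrization_restrict)
    show "symmetrization norm_Fa (i (?T Q)) \<le> 2 * norm Q"
      unfolding sym[OF Q] using 0 by (rule symmetrization_restrict_le)
  next
    fix y e assume "y \<in> Fa" "e > (0 :: real)"
    then show "\<exists>Q\<in>?V. symmetrization norm_Fa (y - i (?T Q)) < e"
      using dense[of y e] unfolding span[symmetric] by blast
  qed (use complete normed_space_on_symmetrization[OF asym] in simp_all)
  then show "normed_isomorphic Fa (symmetrization norm_Fa)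
      (lip_free :: ('a lip0 \<Rightarrow>\<^sub>L real) set) norm"
    by (simp add: lip_free_def)
qed

end
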